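(* If $w$ is a universal Lyndon word of degree $n$, then $\mathrm{MT}(w)$ is a Hamiltonian lex-code of degree $n$. Conversely, if $X\subseteq\Sigma_n^*$ is a Hamiltonian lex-code of degree $n$, then there exists a universal Lyndon word $w$ of degree $n$ such that $X=\mathrm{MT}(w)$.
   Context: $\Sigma_n=\{1,\ldots,n\}$, $\Sigma_n^*$ the set of words over it. For a word $w=a_1\cdots a_m$ a proper conjugate is $w_2w_1$ where $w=w_1w_2$ with $w_1,w_2$ nonempty. A total order on the alphabet induces the lexicographic order on words ($u$ is smaller than $v$ if $u$ is a proper prefix of $v$, or $u=zau'$, $v=zbv'$ with letters $a<b$). A word $w$ over $\Sigma_n$ is a Lyndon word if for some total order on $\Sigma_n$ it is strictly lexicographically smaller than each of its proper conjugates. A universal Lyndon word of degree $n$ is a word over $\Sigma_n$ of length $n!$ all of whose conjugates are Lyndon words. A cyclic factor of $w$ is a nonempty word $u$ with $|u|\le|w|$ that is a factor of $ww$. For a nonempty word $u$, with set of letters $\mathrm{alp}(u)$, $\triangleleft_u$ is the relation on $\Sigma_n$: $i\triangleleft_u j$ iff $i\in\mathrm{alp}(u)$ and either $j\notin\mathrm{alp}(u)$ or the first occurrence of $i$ in $u$ precedes that of $j$. $\mathrm{MT}(w)$ is the set of cyclic factors $u$ of $w$ such that $\triangleleft_u$ is a total order on $\Sigma_n$ and no proper factor $v$ of $u$ (nonempty, different from $u$) satisfies $\triangleleft_v=\triangleleft_u$. A set $X\subseteq\Sigma_n^*$ is a lex-code of degree $n$ if (1) for every $x\in X$ there exists a unique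 total order on $\Sigma_n$ for which $x$ is the lexicographic minimum of $X$, and (2) every proper prefix (nonempty prefix different from the word itself) of a word of $X$ is a prefix of at least two distinct words of $X$. A lex-code $X$ is Hamiltonian if the digraph with vertex set $X$ and edge set $S_X=\{(x,y)\in X\times X:\ x \text{ is a prefix of } ay \text{ for some } a\in\Sigma_n\}$ has a Hamiltonian cycle (a closed walk visiting every vertex exactly once).
   Formalization: The converse assumes that X is not the set consisting of the empty word alone; for n = 1 this set literally satisfies the definition of a Hamiltonian lex-code but is not MT(w) for any w, and for other n it is not a Hamiltonian lex-code. *)

theory Defs
  imports Main "HOL-Library.Sublist" "Graph_Theory.Arc_Walk"
begin

type_synonym word = "nat list"

abbreviation alphabet :: "nat \<Rightarrow> nat set" where
  "alphabet n \<equiv> {1..n}"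

(* Orders are strict and are relations on the alphabet only, so that two different
   relations are two different orders of the alphabet. *)
definition total_order :: "nat \<Rightarrow> nat rel \<Rightarrow> bool" where
  "total_order n r \<longleftrightarrow>
     r \<subseteq> alphabet n \<times> alphabet n \<and> strict_linear_order_on (alphabet n) r"

definition proper_conjugates :: "word \<Rightarrow> word set" where
  "proper_conjugates w = {w2 @ w1 | w1 w2. w = w1 @ w2 \<and> w1 \<noteq> [] \<and> w2 \<noteq> []}"

definition conjugates :: "word \<Rightarrow> word set" where
  "conjugates w = insert w (proper_conjugates w)"

definition lyndon :: "nat \<Rightarrow> word \<Rightarrow> bool" where
  "lyndon n w \<longleftrightarrow> w \<in> lists (alphabet n) \<and>
     (\<exists>r. total_order n r \<and> (\<forall>v\<in>proper_conjugates w. (w, v) \<in> lexord r))"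

definition universal_lyndon :: "nat \<Rightarrow> word \<Rightarrow> bool" where
  "universal_lyndon n w \<longleftrightarrow>
     w \<in> lists (alphabet n) \<and> length w = fact n \<and> (\<forall>v\<in>conjugates w. lyndon n v)"

definition cyclic_factor :: "word \<Rightarrow> word \<Rightarrow> bool" where
  "cyclic_factor u w \<longleftrightarrow> u \<noteq> [] \<and> length u \<le> length w \<and> sublist u (w @ w)"

definition first_occ :: "nat \<Rightarrow> word \<Rightarrow> nat" where
  "first_occ i u = (LEAST k. k < length u \<and> u ! k = i)"

definition tri :: "nat \<Rightarrow> word \<Rightarrow> nat rel" where
  "tri n u = {(i, j) \<in> alphabet n \<times> alphabet n.
     i \<in> set u \<and> (j \<notin> set u \<or> first_occ i u < first_occ j u)}"

definition MT :: "nat \<Rightarrow> word \<Rightarrow> word set" where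
  "MT n w = {u. cyclic_factor u w \<and> total_order n (tri n u) \<and>
     \<not> (\<exists>v. v \<noteq> [] \<and> strict_sublist v u \<and> tri n v = tri n u)}"

definition lex_minimum :: "nat rel \<Rightarrow> word set \<Rightarrow> word \<Rightarrow> bool" where
  "lex_minimum r X x \<longleftrightarrow> x \<in> X \<and> (\<forall>y\<in>X. y \<noteq> x \<longrightarrow> (x, y) \<in> lexord r)"

definition lex_code :: "nat \<Rightarrow> word set \<Rightarrow> bool" where
  "lex_code n X \<longleftrightarrow> X \<subseteq> lists (alphabet n) \<and>
     (\<forall>x\<in>X. \<exists>!r. total_order n r \<and> lex_minimum r X x) \<and>
     (\<forall>x\<in>X. \<forall>u. u \<noteq> [] \<and> strict_prefix u x \<longrightarrow>
        (\<exists>y\<in>X. \<exists>z\<in>X. y \<noteq> z \<and> prefix u y \<and> prefix u z))"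

definition lex_digraph :: "nat \<Rightarrow> word set \<Rightarrow> (word, word \<times> word) pre_digraph" where
  "lex_digraph n X =
     \<lparr> verts = X, arcs = {(x, y) \<in> X \<times> X. \<exists>a\<in>alphabet n. prefix x (a # y)},
       tail = fst, head = snd \<rparr>"

(* A cycle is a nonempty closed walk along which the heads of the arcs are distinct; in
   particular a single vertex is a Hamiltonian cycle only by means of a loop. *)
definition hamiltonian :: "('a, 'b) pre_digraph \<Rightarrow> bool" where
  "hamiltonian G \<longleftrightarrow> (\<exists>p. pre_digraph.cycle G p \<and> head G ` set p = verts G)"

definition hamiltonian_lex_code :: "nat \<Rightarrow> word set \<Rightarrow> bool" where
  "hamiltonian_lex_code n X \<longleftrightarrow> lex_code n X \<and> hamiltonian (lex_digraph n X)"

(* In degree 1, and only there, the set consisting of the empty word alone meets the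
   definition of a Hamiltonian lex-code. It is not of the form MT 1 w, because cyclic
   factors are nonempty. *)
lemma hamiltonian_lex_code_Nil_iff: "hamiltonian_lex_code n {[]} \<longleftrightarrow> n = 1"
proof
  assume H: "hamiltonian_lex_code n {[]}"
  then obtain p where p: "pre_digraph.cycle (lex_digraph n {[]}) p"
    by (auto simp: hamiltonian_lex_code_def hamiltonian_def)
  then have "n \<noteq> 0"
    by (cases p) (auto simp: pre_digraph.cycle_def pre_digraph.awalk_def lex_digraph_def)
  moreover have "\<not> 2 \<le> n"
  proof
    assume n2: "2 \<le> n"
    define r where "r = {(i, j). i \<in> alphabet n \<and> j \<in> alphabet n \<and> i < j}"
    have r: "total_order n r" "total_order n (r\<inverse>)"
      by (auto simp: total_order_def r_def strict_linear_order_on_def trans_def irrefl_def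
          total_on_def)
    from H have "\<exists>!r. total_order n r"
      by (simp add: hamiltonian_lex_code_def lex_code_def lex_minimum_def)
    with r have "r = r\<inverse>" by blast
    moreover have "(1, 2) \<in> r" "(1, 2) \<notin> r\<inverse>" using n2 by (auto simp: r_def)
    ultimately show False by blast
  qed
  ultimately show "n = 1" by linarith
next
  assume n: "n = 1"
  have "total_order n r \<longleftrightarrow> r = {}" for r
    using n by (auto simp: total_order_def strict_linear_order_on_def irrefl_def)
  then have "lex_code n {[]}"
    by (simp add: lex_code_def lex_minimum_def)
  moreover have "pre_digraph.cycle (lex_digraph n {[]}) [([], [])]"
    using n by (simp add: pre_digraph.cycle_def pre_digraph.awalk_def pre_digraph.cas.simps
        pre_digraph.awalk_verts.simps lex_digraph_def)
  then have "hamiltonian (lex_digraph n {[]})"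
    unfolding hamiltonian_def by (intro exI[of _ "[([], [])]"]) (simp add: lex_digraph_def)
  ultimately show "hamiltonian_lex_code n {[]}"
    by (simp add: hamiltonian_lex_code_def)
qed

end

theory Submission
  imports Defs "HOL-Combinatorics.Multiset_Permutations"
begin

text \<open>
  There are as many total orders of the alphabet as conjugates of a universal Lyndon word, so the
  conjugates correspond bijectively to the orders for which they are least. The key point is that
  the order belonging to a conjugate is the order of first occurrences of its letters. Hence
  the elements of \<open>MT n w\<close> are the shortest nonempty prefixes of the conjugates that determine
  this order; they are ordered like the conjugates, and the conjugates of \<open>w\<close> in their cyclic
  sequence give the Hamiltonian cycle. Conversely, the first letters of the words met along a
  Hamiltonian cycle of \<open>X\<close> spell a word \<open>w\<close> whose conjugates extend the elements of \<open>X\<close>. Two words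
  of a lex-code are never prefixes of one another, so the conjugates are ordered like the
  elements of \<open>X\<close>, and \<open>w\<close> is universal Lyndon. The second property of lex-codes, applied to both
  \<open>X\<close> and \<open>MT n w\<close>, forces the two prefixes of each conjugate to have the same length.
\<close>

section \<open>Total orders of the alphabet\<close>

lemma total_orderD:
  assumes "total_order n r"
  shows "r \<subseteq> alphabet n \<times> alphabet n" "trans r" "irrefl r" "total_on (alphabet n) r" "asym r"
proof -
  show *: "r \<subseteq> alphabet n \<times> alphabet n" "trans r" "irrefl r" "total_on (alphabet n) r"
    using assms by (auto simp: total_order_def strict_linear_order_on_def)
  show "asym r"
  proof (rule asymI)
    fix a b assume "(a, b) \<in> r"
    then show "(b, a) \<notin> r" using *(2,3) unfolding trans_def irrefl_def by blast
  qed
qed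

text \<open>A pair of \<open>s\<close> missing from \<open>r\<close> would appear reversed in
  \<open>r\<close> by totality, hence in \<open>s\<close>, against asymmetry.\<close>

lemma total_order_subset_eq:
  assumes r: "total_order n r" and s: "total_order n s" and "r \<subseteq> s"
  shows "r = s"
proof -
  have "(a, b) \<in> r" if ab: "(a, b) \<in> s" for a b
  proof (rule ccontr)
    assume "(a, b) \<notin> r"
    moreover have "a \<in> alphabet n" "b \<in> alphabet n" "a \<noteq> b"
      using ab total_orderD(1,3)[OF s] by (auto simp: irrefl_def)
    ultimately have "(b, a) \<in> r"
      using total_orderD(4)[OF r] unfolding total_on_def by blast
    then show False
      using ab \<open>r \<subseteq> s\<close> asymD[OF total_orderD(5)[OF s]] by blast
  qed
  with assms(3) show ?thesis by auto
qed

lemma strict_linear_minimum: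
  assumes "finite A" "A \<noteq> {}" "trans r" "total_on A r"
  shows "\<exists>x\<in>A. \<forall>y\<in>A. y \<noteq> x \<longrightarrow> (x, y) \<in> r"
  using assms(1,2,4)
proof (induction A rule: finite_ne_induct)
  case (insert a A)
  then have "total_on A r" by (auto simp: total_on_def)
  with insert obtain x where x: "x \<in> A" "\<forall>y\<in>A. y \<noteq> x \<longrightarrow> (x, y) \<in> r" by blast
  show ?case
  proof (cases "(x, a) \<in> r")
    case False
    with insert x have "(a, x) \<in> r" by (auto simp: total_on_def)
    have "(a, y) \<in> r" if "y \<in> A" for y
      using x(2) that \<open>(a, x) \<in> r\<close> transD[OF \<open>trans r\<close>, of a x y] by (cases "y = x") auto
    then show ?thesis by auto
  qed (use x in auto)
qed auto

lemma sorted_wrt_exists: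
  assumes "finite A" "trans r" "total_on A r"
  shows "\<exists>xs. set xs = A \<and> distinct xs \<and> sorted_wrt (\<lambda>a b. (a, b) \<in> r) xs"
  using assms(1,3)
proof (induction "card A" arbitrary: A)
  case (Suc k)
  then have "A \<noteq> {}" by auto
  then obtain x where x: "x \<in> A" "\<forall>y\<in>A. y \<noteq> x \<longrightarrow> (x, y) \<in> r"
    using strict_linear_minimum Suc.prems assms(2) by blast
  have "k = card (A - {x})" using Suc.hyps(2) x(1) by (simp add: Suc.prems)
  moreover have "total_on (A - {x}) r" using Suc.prems by (auto simp: total_on_def)
  ultimately obtain xs where "set xs = A - {x}" "distinct xs" "sorted_wrt (\<lambda>a b. (a, b) \<in> r) xs"
    using Suc.hyps(1)[of "A - {x}"] Suc.prems by auto
  then have "set (x # xs) = A \<and> distinct (x # xs) \<and> sorted_wrt (\<lambda>a b. (a, b) \<in> r) (x # xs)"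
    using x by auto
  then show ?case by blast
qed auto

lemma sorted_wrt_unique:
  assumes "asym r" "sorted_wrt (\<lambda>a b. (a, b) \<in> r) xs" "sorted_wrt (\<lambda>a b. (a, b) \<in> r) ys"
    "set xs = set ys"
  shows "xs = ys"
  using assms(2-4)
proof (induction xs arbitrary: ys)
  case (Cons x xs)
  then obtain y ys' where ys: "ys = y # ys'" by (cases ys) auto
  have "x \<in> insert y (set ys')" "y \<in> insert x (set xs)" using Cons.prems(3) ys by auto
  then have "x = y" using Cons.prems(1,2) ys asymD[OF assms(1), of x y] by auto
  moreover have "x \<notin> set xs" "y \<notin> set ys'"
    using Cons.prems ys asymD[OF assms(1), of x x] asymD[OF assms(1), of y y] by auto
  ultimately have "set xs = set ys'" using Cons.prems(3) ys by (simp add: insert_ident)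
  then show ?case using Cons.IH[of ys'] Cons.prems(1,2) ys \<open>x = y\<close> by simp
qed auto

section \<open>Total orders as permutations of the alphabet\<close>

definition order_of_list :: "'a list \<Rightarrow> 'a rel" where
  "order_of_list xs = {(xs ! i, xs ! j) | i j. i < j \<and> j < length xs}"

lemma sorted_order_of_list: "sorted_wrt (\<lambda>a b. (a, b) \<in> order_of_list xs) xs"
  by (auto simp: sorted_wrt_iff_nth_less order_of_list_def)

lemma total_order_order_of_list:
  assumes "set xs = alphabet n" "distinct xs"
  shows "total_order n (order_of_list xs)"
proof -
  have nth_inj: "i = j" if "xs ! i = xs ! j" "i < length xs" "j < length xs" for i j
    using that assms(2) nth_eq_iff_index_eq by blast
  have "trans (order_of_list xs)"
  proof (rule transI)
    fix a b c assume "(a, b) \<in> order_of_list xs" "(b, c) \<in> order_of_list xs"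
    then obtain i j k l where ijkl: "a = xs ! i" "b = xs ! j" "i < j" "j < length xs"
      "b = xs ! k" "c = xs ! l" "k < l" "l < length xs"
      unfolding order_of_list_def by blast
    then have "j = k" using nth_inj[of j k] by simp
    with ijkl have "i < l" by simp
    with ijkl show "(a, c) \<in> order_of_list xs" unfolding order_of_list_def by blast
  qed
  moreover have "irrefl (order_of_list xs)"
    unfolding irrefl_def order_of_list_def using nth_inj by fastforce
  moreover have "total_on (alphabet n) (order_of_list xs)"
  proof (rule total_onI)
    fix a b assume "a \<in> alphabet n" "b \<in> alphabet n" "a \<noteq> b"
    then obtain i j where "a = xs ! i" "b = xs ! j" "i < length xs" "j < length xs" "i \<noteq> j"
      unfolding assms(1)[symmetric] in_set_conv_nth by blast
    then show "(a, b) \<in> order_of_list xs \<or> (b, a) \<in> order_of_list xs"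
      unfolding order_of_list_def by (cases "i < j") (auto simp: not_less le_less)
  qed
  moreover have "order_of_list xs \<subseteq> set xs \<times> set xs"
    by (auto simp: order_of_list_def)
  ultimately show ?thesis
    using assms(1) by (auto simp: total_order_def strict_linear_order_on_def)
qed

text \<open>Listing the alphabet increasingly inverts \<open>order_of_list\<close>, so the orders
  are counted by permutations.\<close>

lemma card_total_orders: "card {r. total_order n r} = fact n"
proof -
  have "bij_betw order_of_list (permutations_of_set (alphabet n)) {r. total_order n r}"
  proof (rule bij_betwI')
    fix xs ys :: "nat list"
    assume xy: "xs \<in> permutations_of_set (alphabet n)" "ys \<in> permutations_of_set (alphabet n)"
    show "order_of_list xs = order_of_list ys \<longleftrightarrow> xs = ys"
    proof
      assume eq: "order_of_list xs = order_of_list ys"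
      have "asym (order_of_list xs)"
        using total_orderD(5)[OF total_order_order_of_list] xy by (auto simp: permutations_of_set_def)
      then show "xs = ys"
        using sorted_wrt_unique sorted_order_of_list[of xs] sorted_order_of_list[of ys]
        by (metis eq permutations_of_setD(1) xy)
    qed simp
  next
    fix xs assume "xs \<in> permutations_of_set (alphabet n)"
    then show "order_of_list xs \<in> {r. total_order n r}"
      using total_order_order_of_list by (auto simp: permutations_of_set_def)
  next
    fix r assume "r \<in> {r. total_order n r}"
    then have r: "total_order n r" by simp
    then obtain xs where xs: "set xs = alphabet n" "distinct xs" "sorted_wrt (\<lambda>a b. (a, b) \<in> r) xs"
      using sorted_wrt_exists[of "alphabet n" r] total_orderD[OF r] by force
    then have "order_of_list xs \<subseteq> r"
      by (auto simp: order_of_list_def sorted_wrt_iff_nth_less)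
    then have "r = order_of_list xs"
      using total_order_subset_eq total_order_order_of_list xs r by metis
    with xs show "\<exists>xs\<in>permutations_of_set (alphabet n). r = order_of_list xs" by blast
  qed
  then show ?thesis by (auto dest: bij_betw_same_card)
qed

lemma finite_total_orders: "finite {r. total_order n r}"
  using card_total_orders[of n] by (metis card_eq_0_iff fact_nonzero)

lemma total_on_lexord:
  assumes "total_on A r"
  shows "total_on (lists A) (lexord r)"
proof -
  have "(xs, ys) \<in> lexord r \<or> xs = ys \<or> (ys, xs) \<in> lexord r"
    if "xs \<in> lists A" "ys \<in> lists A" for xs ys
    using that
  proof (induction xs arbitrary: ys)
    case (Cons x xs)
    then show ?case using assms by (cases ys) (auto simp: total_on_def)
  next
    case (Nil ys)
    then show ?case by (cases ys) auto
  qed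
  then show ?thesis by (auto simp: total_on_def)
qed

section \<open>Exchanging neighbours in a total order\<close>

lemma total_order_flip:
  assumes "total_order n r" "(a, b) \<in> r" "\<And>c. (a, c) \<in> r \<Longrightarrow> (c, b) \<notin> r"
  shows "total_order n (insert (b, a) (r - {(a, b)}))"
proof -
  have sub: "r \<subseteq> alphabet n \<times> alphabet n" and tr: "\<And>x y z. (x, y) \<in> r \<Longrightarrow> (y, z) \<in> r \<Longrightarrow> (x, z) \<in> r"
    and irr: "\<And>x. (x, x) \<notin> r" and tot: "\<And>x y. x \<in> alphabet n \<Longrightarrow> y \<in> alphabet n \<Longrightarrow> x \<noteq> y \<Longrightarrow> (x, y) \<in> r \<or> (y, x) \<in> r"
    using total_orderD[OF assms(1)] by (auto simp: irrefl_def total_on_def dest: transD)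
  have ab: "a \<in> alphabet n" "b \<in> alphabet n" "a \<noteq> b" using assms(2) sub irr by auto
  let ?s = "insert (b, a) (r - {(a, b)})"
  have "(x, z) \<in> ?s" if *: "(x, y) \<in> ?s" "(y, z) \<in> ?s" for x y z
  proof -
    have mem: "\<And>x y. (x, y) \<in> r \<Longrightarrow> x \<in> alphabet n \<and> y \<in> alphabet n" using sub by auto
    \<comment> \<open>Nothing lies between \<open>a\<close> and \<open>b\<close>. This settles the
      composites with the new pair, and it keeps two old pairs from composing to the removed pair
      \<open>(a, b)\<close>.\<close>
    consider "(x, y) = (b, a)" "(y, z) = (b, a)" | "(x, y) = (b, a)" "(y, z) \<in> r" "z \<noteq> b"
      | "(x, y) \<in> r" "x \<noteq> a" "(y, z) = (b, a)" | "(x, y) \<in> r" "(y, z) \<in> r"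
      using * ab by auto
    then show ?thesis
    proof cases
      case 2
      then show ?thesis using tot[of b z] assms(3)[of z] mem ab by auto
    next
      case 3
      then show ?thesis using tot[of x a] assms(3)[of x] mem ab by auto
    next
      case 4
      then show ?thesis using tr assms(3) by blast
    qed (use ab in auto)
  qed
  then have "trans ?s" by (rule transI)
  moreover have "irrefl ?s" using irr ab by (auto simp: irrefl_def)
  moreover have "total_on (alphabet n) ?s" using tot by (fastforce simp: total_on_def)
  ultimately show ?thesis
    using sub ab by (auto simp: total_order_def strict_linear_order_on_def)
qed

text \<open>Among the pairs of \<open>S\<close>, one with the fewest letters in between is adjacent:
  a letter in between would, by \<open>split\<close>, yield a pair of \<open>S\<close> with a
  smaller gap.\<close>

lemma adjacent_pair_exists:
  assumes "total_order n r" "S \<subseteq> r" "S \<noteq> {}"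
    and split: "\<And>a b c. (a, b) \<in> S \<Longrightarrow> (a, c) \<in> r \<Longrightarrow> (c, b) \<in> r \<Longrightarrow> (a, c) \<in> S \<or> (c, b) \<in> S"
  obtains a b where "(a, b) \<in> S" "\<And>c. (a, c) \<in> r \<Longrightarrow> (c, b) \<notin> r"
proof -
  define gap where "gap = (\<lambda>(a, b). {c. (a, c) \<in> r \<and> (c, b) \<in> r})"
  note r = total_orderD[OF assms(1)]
  have fin: "finite (gap p)" for p
    by (rule finite_subset[of _ "alphabet n"]) (use r(1) in \<open>auto simp: gap_def\<close>)
  obtain p where p: "p \<in> S" "\<And>q. q \<in> S \<Longrightarrow> card (gap p) \<le> card (gap q)"
    using assms(3) ex_has_least_nat[of "\<lambda>p. p \<in> S" _ "\<lambda>p. card (gap p)"] by blast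
  obtain a b where ab: "p = (a, b)" by fastforce
  have "(c, b) \<notin> r" if ac: "(a, c) \<in> r" for c
  proof
    assume cb: "(c, b) \<in> r"
    have c: "c \<in> gap (a, b)" "c \<notin> gap (a, c)" "c \<notin> gap (c, b)"
      using ac cb r(3) by (auto simp: gap_def irrefl_def)
    have "gap (a, c) \<subseteq> gap (a, b)" "gap (c, b) \<subseteq> gap (a, b)"
      using transD[OF r(2) _ cb] transD[OF r(2) ac] by (auto simp: gap_def)
    with c have "gap (a, c) \<subset> gap (a, b)" "gap (c, b) \<subset> gap (a, b)" by blast+
    then have "card (gap (a, c)) < card (gap p)" "card (gap (c, b)) < card (gap p)"
      using fin ab by (auto intro: psubset_card_mono)
    then show False using split[of a b c] p ab ac cb by (metis leD)
  qed
  then show thesis using that p(1) ab by blast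
qed

section \<open>The order of first occurrences\<close>

lemma nth_first_occ:
  assumes "i \<in> set u"
  shows "first_occ i u < length u" "u ! first_occ i u = i"
  using assms LeastI_ex[of "\<lambda>k. k < length u \<and> u ! k = i"]
  by (auto simp: first_occ_def in_set_conv_nth)

lemma first_occ_le: "k < length u \<Longrightarrow> u ! k = i \<Longrightarrow> first_occ i u \<le> k"
  by (simp add: first_occ_def Least_le)

text \<open>The witness \<open>m\<close> may be any occurrence of \<open>a\<close> preceded by no
  \<open>b\<close>. This form avoids least positions and carries over directly to extensions of
  \<open>u\<close>.\<close>

lemma tri_iff:
  "(a, b) \<in> tri n u \<longleftrightarrow> a \<in> alphabet n \<and> b \<in> alphabet n \<and>
     (\<exists>m<length u. u ! m = a \<and> (\<forall>l\<le>m. u ! l \<noteq> b))" (is "_ \<longleftrightarrow> _ \<and> _ \<and> ?P")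
proof -
  have "a \<in> set u \<and> (b \<notin> set u \<or> first_occ a u < first_occ b u) \<longleftrightarrow> ?P"
  proof
    assume *: "a \<in> set u \<and> (b \<notin> set u \<or> first_occ a u < first_occ b u)"
    have "u ! l \<noteq> b" if "l \<le> first_occ a u" for l
      using * that nth_first_occ(1)[of a u] first_occ_le[of l u b]
      by (metis le_less_trans not_le nth_mem)
    with * show ?P using nth_first_occ[of a u] by blast
  next
    assume ?P
    then obtain m where m: "m < length u" "u ! m = a" "\<forall>l\<le>m. u ! l \<noteq> b" by blast
    then have "a \<in> set u" by auto
    moreover have "first_occ a u < first_occ b u" if "b \<in> set u"
      using m first_occ_le[of m u a] nth_first_occ[OF that] by (meson le_less_trans not_le)
    ultimately show "a \<in> set u \<and> (b \<notin> set u \<or> first_occ a u < first_occ b u)" by blast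
  qed
  then show ?thesis unfolding tri_def by auto
qed

lemma asym_tri: "(a, b) \<in> tri n u \<Longrightarrow> (b, a) \<notin> tri n u"
  unfolding tri_iff by (metis le_cases)

text \<open>Only two letters that are both absent are incomparable. Totality thus depends on the
  letter set alone and holds as soon as at most one letter is missing.\<close>

lemma total_order_tri_iff:
  "total_order n (tri n u) \<longleftrightarrow>
     (\<forall>a\<in>alphabet n. \<forall>b\<in>alphabet n. a \<noteq> b \<longrightarrow> a \<in> set u \<or> b \<in> set u)"
proof -
  have "trans (tri n u)"
    unfolding tri_def trans_def by auto
  moreover have "irrefl (tri n u)"
    unfolding tri_def irrefl_def by auto
  moreover have "tri n u \<subseteq> alphabet n \<times> alphabet n"
    unfolding tri_def by auto
  moreover have "total_on (alphabet n) (tri n u) \<longleftrightarrow>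
     (\<forall>a\<in>alphabet n. \<forall>b\<in>alphabet n. a \<noteq> b \<longrightarrow> a \<in> set u \<or> b \<in> set u)"
  proof -
    have "(a, b) \<in> tri n u \<or> (b, a) \<in> tri n u \<longleftrightarrow> a \<in> set u \<or> b \<in> set u"
      if "a \<in> alphabet n" "b \<in> alphabet n" "a \<noteq> b" for a b
    proof -
      have "first_occ a u \<noteq> first_occ b u" if "a \<in> set u" "b \<in> set u"
        using nth_first_occ(2)[OF that(1)] nth_first_occ(2)[OF that(2)] \<open>a \<noteq> b\<close> by metis
      then show ?thesis using that unfolding tri_def by (auto simp: nat_neq_iff)
    qed
    then show ?thesis unfolding total_on_def by blast
  qed
  ultimately show ?thesis
    unfolding total_order_def strict_linear_order_on_def by blast
qed

lemma tri_mono_prefix: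
  assumes "prefix u v"
  shows "tri n u \<subseteq> tri n v"
proof (rule subrelI)
  fix a b assume "(a, b) \<in> tri n u"
  moreover have "length u \<le> length v" "\<forall>m<length u. v ! m = u ! m"
    using assms by (auto simp: prefix_def nth_append)
  ultimately show "(a, b) \<in> tri n v" unfolding tri_iff by (metis le_less_trans less_le_trans)
qed

lemma tri_prefix_eq:
  assumes "prefix u v" "total_order n (tri n u)"
  shows "tri n v = tri n u" "total_order n (tri n v)"
proof -
  show v: "total_order n (tri n v)"
    using assms set_mono_prefix[OF assms(1)] unfolding total_order_tri_iff by blast
  show "tri n v = tri n u"
    using total_order_subset_eq[OF assms(2) v tri_mono_prefix[OF assms(1)]] by simp
qed

section \<open>Windows of a sequence\<close>

text \<open>Windows of a periodic sequence represent conjugates and cyclic factors alike, without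
  wrapping around the end of a word.\<close>

definition seg :: "(nat \<Rightarrow> 'a) \<Rightarrow> nat \<Rightarrow> nat \<Rightarrow> 'a list" where
  "seg W i l = map W [i..<i + l]"

lemma length_seg [simp]: "length (seg W i l) = l"
  by (simp add: seg_def)

lemma nth_seg [simp]: "k < l \<Longrightarrow> seg W i l ! k = W (i + k)"
  by (simp add: seg_def)

lemma seg_eq_Nil_iff [simp]: "seg W i l = [] \<longleftrightarrow> l = 0"
  by (auto simp: seg_def)

lemma seg_Suc: "seg W i (Suc l) = W i # seg W (Suc i) l"
  by (rule nth_equalityI) (auto simp: nth_Cons split: nat.split)

lemma seg_add: "seg W i (k + l) = seg W i k @ seg W (i + k) l"
  by (rule nth_equalityI) (auto simp: nth_append)

lemma take_seg: "k \<le> l \<Longrightarrow> take k (seg W i l) = seg W i k"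
  by (rule nth_equalityI) auto

lemma seg_eq_iff: "seg W i l = seg W j l \<longleftrightarrow> (\<forall>k<l. W (i + k) = W (j + k))"
  by (auto simp: list_eq_iff_nth_eq)

lemma prefix_seg: "k \<le> l \<Longrightarrow> prefix (seg W i k) (seg W i l)"
  by (metis take_is_prefix take_seg)

lemma prefix_segD: "prefix u (seg W i l) \<Longrightarrow> u = seg W i (length u) \<and> length u \<le> l"
  by (metis length_seg prefix_def prefix_length_le append_eq_conv_conj take_seg)

lemma sublist_segD:
  assumes "sublist u (seg W i l)"
  obtains d where "u = seg W (i + d) (length u)" "d + length u \<le> l"
proof -
  obtain p q where pq: "seg W i l = p @ u @ q" using assms by (auto simp: sublist_def)
  then have l: "l = length p + (length u + length q)" by (metis length_append length_seg)
  have "p @ u @ q = seg W i (length p) @ seg W (i + length p) (length u) @ seg W (i + length p + length u) (length q)"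
    by (simp only: pq[symmetric] l seg_add)
  then have "u = seg W (i + length p) (length u)" by simp
  with l show thesis using that by simp
qed

section \<open>Periodic sequences realising every order\<close>

text \<open>
  \<open>W\<close> is the periodic sequence whose windows of length \<open>N\<close> are the conjugates of the word, and
  \<open>R i\<close> is the order for which the conjugate starting at \<open>i\<close> is least.
\<close>

locale cyclic_lyndon =
  fixes n N :: nat and W :: "nat \<Rightarrow> nat" and R :: "nat \<Rightarrow> nat rel"
  assumes N_pos: "0 < N"
    and W_alphabet: "W i \<in> alphabet n"
    and W_mod: "W (i mod N) = W i"
    and R_mod: "R (i mod N) = R i"
    and R_order: "total_order n (R i)"
    and R_surj: "total_order n r \<Longrightarrow> \<exists>i. r = R i"
    and R_less: "i mod N \<noteq> j mod N \<Longrightarrow>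
      \<exists>k. (\<forall>l<k. W (i + l) = W (j + l)) \<and> (W (i + k), W (j + k)) \<in> R i"
begin

lemma W_cong: "i mod N = j mod N \<Longrightarrow> W (i + k) = W (j + k)"
  by (metis W_mod mod_add_left_eq)

lemma seg_cong: "i mod N = j mod N \<Longrightarrow> seg W i l = seg W j l"
  unfolding seg_eq_iff using W_cong by blast

lemma R_asym: "(a, b) \<in> R i \<Longrightarrow> (b, a) \<notin> R i"
  using asymD[OF total_orderD(5)[OF R_order]] .

lemma R_less_bounded:
  assumes "i mod N \<noteq> j mod N"
  obtains k where "k < N" "\<And>l. l < k \<Longrightarrow> W (i + l) = W (j + l)" "(W (i + k), W (j + k)) \<in> R i"
proof -
  obtain k where k: "\<forall>l<k. W (i + l) = W (j + l)" "(W (i + k), W (j + k)) \<in> R i"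
    using R_less[OF assms] by blast
  have "k < N"
  proof (rule ccontr)
    assume "\<not> k < N"
    \<comment> \<open>By periodicity, a difference at \<open>k\<close> would already show one period
      earlier.\<close>
    then have "W (i + (k - N)) = W (j + (k - N))" using k(1) N_pos \<open>\<not> k < N\<close> by (simp del: Nat.add_diff_assoc Nat.add_diff_assoc2)
    moreover have "W (a + (k - N)) = W (a + k)" for a
    proof -
      have "a + k = a + (k - N) + N" using \<open>\<not> k < N\<close> by simp
      then show ?thesis using W_mod by (metis mod_add_self2)
    qed
    ultimately show False using k(2) R_asym by metis
  qed
  with k that show thesis by blast
qed

lemma R_eq_iff: "R i = R j \<longleftrightarrow> i mod N = j mod N"
proof
  assume eq: "R i = R j"
  show "i mod N = j mod N"
  proof (rule ccontr)
    assume neq: "i mod N \<noteq> j mod N"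
    obtain k where k: "\<And>l. l < k \<Longrightarrow> W (i + l) = W (j + l)" "(W (i + k), W (j + k)) \<in> R i"
      using R_less_bounded[OF neq] by blast
    obtain k' where k': "\<And>l. l < k' \<Longrightarrow> W (j + l) = W (i + l)" "(W (j + k'), W (i + k')) \<in> R j"
      using R_less_bounded[OF neq[symmetric]] by blast
    have "k = k'"
      using k k' R_asym by (metis linorder_neqE_nat)
    with k(2) k'(2) eq R_asym show False by metis
  qed
qed (metis R_mod)

text \<open>The first letter of a conjugate is the least of all occurring letters: a conjugate
  starting with another letter differs from it at position 0.\<close>

lemma R_first:
  assumes "W j \<noteq> W i"
  shows "(W i, W j) \<in> R i"
proof -
  have "i mod N \<noteq> j mod N" using assms by (metis W_mod)
  then obtain k where k: "\<And>l. l < k \<Longrightarrow> W (i + l) = W (j + l)" "(W (i + k), W (j + k)) \<in> R i"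
    using R_less_bounded by blast
  then have "k = 0" using assms by (metis add.right_neutral gr0I)
  with k show ?thesis by simp
qed

text \<open>The exchanged order is some \<open>R j\<close>. At their first difference the two
  conjugates are compared oppositely by \<open>R i\<close> and \<open>R j\<close>, and these
  disagree only on \<open>a\<close> and \<open>b\<close>.\<close>

lemma R_flip:
  assumes "(a, b) \<in> R i" "\<And>c. (a, c) \<in> R i \<Longrightarrow> (c, b) \<notin> R i"
  obtains j k where "i mod N \<noteq> j mod N" "k < N" "\<And>l. l < k \<Longrightarrow> W (i + l) = W (j + l)"
    "W (i + k) = a" "W (j + k) = b"
proof -
  obtain j where j: "insert (b, a) (R i - {(a, b)}) = R j"
    using R_surj[OF total_order_flip[OF R_order[of i] assms]] by blast
  have "(b, a) \<in> R j" "(b, a) \<notin> R i" using assms(1) R_asym unfolding j[symmetric] by auto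
  then have neq: "i mod N \<noteq> j mod N" using R_eq_iff by metis
  then obtain k where k: "k < N" "\<And>l. l < k \<Longrightarrow> W (i + l) = W (j + l)" "(W (i + k), W (j + k)) \<in> R i"
    using R_less_bounded by blast
  obtain k' where k': "\<And>l. l < k' \<Longrightarrow> W (j + l) = W (i + l)" "(W (j + k'), W (i + k')) \<in> R j"
    using R_less_bounded[OF neq[symmetric]] by blast
  have "k = k'"
    using k k' R_asym by (metis linorder_neqE_nat)
  then have "(W (j + k), W (i + k)) \<in> R j" using k' by simp
  then have "W (i + k) = a" "W (j + k) = b"
    using k(3) R_asym unfolding j[symmetric] by auto
  with neq k show thesis using that by blast
qed

text \<open>
  It suffices to treat neighbours \<open>a\<close>, \<open>b\<close> in \<open>R i\<close>. Exchanging them changes the least conjugate, and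
  the two conjugates first differ in these very letters, after a common prefix \<open>y\<close>. If \<open>b\<close> occurred
  in \<open>y\<close>, then the conjugate starting at that occurrence would have an order whose least letter is
  \<open>b\<close>, yet \<open>a\<close> would precede \<open>b\<close> in it, because the same conjugate is compared with one that has \<open>b\<close>
  in place of \<open>a\<close>.
\<close>

theorem tri_conjugate: "tri n (seg W i N) = R i"
proof -
  have "R i - tri n (seg W i N) = {}"
  proof (rule ccontr)
    let ?S = "R i - tri n (seg W i N)"
    assume "?S \<noteq> {}"
    \<comment> \<open>If both pairs were in the relation \<open>tri\<close>, then so would be
      \<open>(a, b)\<close>, by transitivity.\<close>
    moreover have "(a, c) \<in> ?S \<or> (c, b) \<in> ?S"
      if "(a, b) \<in> ?S" "(a, c) \<in> R i" "(c, b) \<in> R i" for a b c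
      using that unfolding tri_def by auto
    ultimately obtain a b where ab: "(a, b) \<in> ?S" "\<And>c. (a, c) \<in> R i \<Longrightarrow> (c, b) \<notin> R i"
      using adjacent_pair_exists[OF R_order[of i], of ?S] by blast
    then obtain j k where k: "k < N" "\<And>l. l < k \<Longrightarrow> W (i + l) = W (j + l)"
      and Wk: "W (i + k) = a" "W (j + k) = b"
      using R_flip[of a b i] by blast
    have "W (i + m) \<noteq> b" if "m \<le> k" for m
    proof
      assume m: "W (i + m) = b"
      have "m < k" using that m Wk(1) ab(1) R_asym by (metis DiffD1 le_neq_implies_less)
      have less: "(b, a) \<in> R (i + m)"
        using R_first[of "i + k" "i + m"] m Wk(1) ab(1) R_asym by (metis DiffD1)
      have agree: "W (i + m + l) = W (j + m + l)" if "l < k - m" for l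
        using k(2)[of "m + l"] that by (simp add: add.assoc)
      have *: "W (i + m + (k - m)) = a" "W (j + m + (k - m)) = b"
        using Wk \<open>m < k\<close> by (simp_all add: add.assoc)
      have "a \<noteq> b" using less R_asym by blast
      then have "(i + m) mod N \<noteq> (j + m) mod N" using W_cong * by metis
      then obtain q where q: "\<And>l. l < q \<Longrightarrow> W (i + m + l) = W (j + m + l)"
        "(W (i + m + q), W (j + m + q)) \<in> R (i + m)"
        using R_less_bounded by blast
      have "q = k - m"
        using q agree * \<open>a \<noteq> b\<close> R_asym by (metis linorder_neqE_nat)
      then have "(a, b) \<in> R (i + m)" using q(2) * by simp
      with less R_asym show False by blast
    qed
    then have "\<forall>l\<le>k. seg W i N ! l \<noteq> b" "seg W i N ! k = a" "k < length (seg W i N)"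
      using k(1) Wk(1) by simp_all
    moreover have "a \<in> alphabet n" "b \<in> alphabet n"
      using ab(1) total_orderD(1)[OF R_order[of i]] by auto
    ultimately have "(a, b) \<in> tri n (seg W i N)"
      unfolding tri_iff by blast
    with ab(1) show False by blast
  qed
  then have sub: "R i \<subseteq> tri n (seg W i N)" by blast
  \<comment> \<open>Since \<open>R i\<close> is total and \<open>tri\<close> is asymmetric, the
    inclusion cannot be strict.\<close>
  have "(a, b) \<in> R i" if "(a, b) \<in> tri n (seg W i N)" for a b
  proof (rule ccontr)
    assume "(a, b) \<notin> R i"
    moreover have "a \<noteq> b" using that asym_tri by blast
    moreover have "a \<in> alphabet n" "b \<in> alphabet n" using that unfolding tri_iff by auto
    ultimately have "(b, a) \<in> R i" using total_orderD(4)[OF R_order[of i]] unfolding total_on_def by blast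
    with sub that asym_tri show False by blast
  qed
  with sub show ?thesis by auto
qed

section \<open>Codewords: the shortest windows that determine their order\<close>

text \<open>The condition \<open>0 < l\<close> matters in degree 1, where the empty window already
  gives the only order but is not a cyclic factor.\<close>

definition code_len :: "nat \<Rightarrow> nat" where
  "code_len i = (LEAST l. 0 < l \<and> total_order n (tri n (seg W i l)))"

definition code :: "nat \<Rightarrow> word" where
  "code i = seg W i (code_len i)"

lemma code_len:
  "0 < code_len i" "total_order n (tri n (seg W i (code_len i)))"
  and code_len_le: "0 < l \<Longrightarrow> total_order n (tri n (seg W i l)) \<Longrightarrow> code_len i \<le> l"
  and code_len_le_N: "code_len i \<le> N"
proof -
  have N: "0 < N \<and> total_order n (tri n (seg W i N))"
    using N_pos R_order by (simp add: tri_conjugate)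
  show "0 < code_len i" "total_order n (tri n (seg W i (code_len i)))"
    using LeastI[of "\<lambda>l. 0 < l \<and> total_order n (tri n (seg W i l))", OF N]
    by (auto simp: code_len_def)
  show "code_len i \<le> l" if "0 < l" "total_order n (tri n (seg W i l))" for l
    using that by (simp add: code_len_def Least_le)
  then show "code_len i \<le> N" using N by blast
qed

text \<open>The windows of lengths \<open>l\<close> and \<open>N\<close> both determine the order of
  their common extension of length \<open>max l N\<close>.\<close>

lemma tri_seg_total:
  assumes "total_order n (tri n (seg W i l))"
  shows "tri n (seg W i l) = R i"
proof -
  have N: "total_order n (tri n (seg W i N))"
    using R_order by (simp add: tri_conjugate)
  have "tri n (seg W i (max l N)) = tri n (seg W i l)"
    by (rule tri_prefix_eq(1)[OF prefix_seg assms]) simp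
  moreover have "tri n (seg W i (max l N)) = tri n (seg W i N)"
    by (rule tri_prefix_eq(1)[OF prefix_seg N]) simp
  ultimately show ?thesis by (simp add: tri_conjugate)
qed

lemma tri_seg_total_iff:
  assumes "0 < l"
  shows "total_order n (tri n (seg W i l)) \<longleftrightarrow> code_len i \<le> l"
  using code_len_le[OF assms] tri_prefix_eq(2)[OF prefix_seg[of "code_len i" l W i] code_len(2)]
  by blast

lemma tri_code: "tri n (code i) = R i"
  using code_len(2) tri_seg_total by (simp add: code_def)

lemma code_cong:
  assumes "i mod N = j mod N"
  shows "code i = code j"
proof -
  have "seg W i = seg W j" using seg_cong[OF assms] by blast
  then show ?thesis by (simp add: code_def code_len_def)
qed

lemma code_eq_iff: "code i = code j \<longleftrightarrow> i mod N = j mod N"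
  using code_cong tri_code R_eq_iff by metis

lemma cyclic_factor_seg:
  "cyclic_factor u (seg W 0 N) \<longleftrightarrow> (\<exists>i l. 0 < l \<and> l \<le> N \<and> u = seg W i l)"
proof -
  have ww: "seg W 0 N @ seg W 0 N = seg W 0 (N + N)"
    using seg_cong[of N 0] by (simp add: seg_add)
  show ?thesis
  proof
    assume *: "cyclic_factor u (seg W 0 N)"
    then obtain d where "u = seg W (0 + d) (length u)"
      using sublist_segD unfolding cyclic_factor_def ww by metis
    with * show "\<exists>i l. 0 < l \<and> l \<le> N \<and> u = seg W i l"
      unfolding cyclic_factor_def by (metis length_greater_0_conv length_seg)
  next
    assume "\<exists>i l. 0 < l \<and> l \<le> N \<and> u = seg W i l"
    then obtain i l where il: "0 < l" "l \<le> N" "u = seg W i l" by blast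
    define d where "d = i mod N"
    have "d < N" using N_pos by (simp add: d_def)
    have u: "u = seg W d l" using il(3) seg_cong[of i d l] by (simp add: d_def)
    have "N + N = d + (l + (N + N - (d + l)))" using il(2) \<open>d < N\<close> by simp
    then have "seg W 0 (N + N) = seg W 0 d @ u @ seg W (d + l) (N + N - (d + l))"
      using u by (metis add_0 seg_add)
    then show "cyclic_factor u (seg W 0 N)"
      unfolding cyclic_factor_def ww sublist_def using il u by auto
  qed
qed

text \<open>A window longer than its codeword contains that codeword, which has the same order.
  Conversely, a factor of \<open>code i\<close> with the same order must start at a position
  congruent to \<open>i\<close>, hence at offset 0, and cannot be shorter than
  \<open>code_len i\<close>.\<close>

lemma MT_eq: "MT n (seg W 0 N) = range code"
proof (intro equalityI subsetI)
  fix u assume "u \<in> MT n (seg W 0 N)"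
  then obtain i l where u: "0 < l" "u = seg W i l" "total_order n (tri n u)"
    and min: "\<And>v. v \<noteq> [] \<Longrightarrow> strict_sublist v u \<Longrightarrow> tri n v \<noteq> tri n u"
    unfolding MT_def cyclic_factor_seg by blast
  have "code_len i \<le> l" using u code_len_le by simp
  moreover have "\<not> code_len i < l"
  proof
    assume "code_len i < l"
    then have "prefix (code i) u" "code i \<noteq> u"
      using u(2) prefix_seg[of "code_len i" l W i] by (auto simp: code_def dest: arg_cong[where f = length])
    then have "strict_sublist (code i) u"
      by (simp add: strict_sublist_def sublist_order.less_le prefix_imp_sublist)
    moreover have "code i \<noteq> []" using code_len(1)[of i] by (simp add: code_def)
    ultimately show False using min tri_code u tri_seg_total by metis
  qed
  ultimately have "u = code i" using u(2) by (simp add: code_def)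
  then show "u \<in> range code" by blast
next
  fix u assume "u \<in> range code"
  then obtain i where i: "u = code i" by blast
  have "tri n v \<noteq> tri n u" if v: "v \<noteq> []" "strict_sublist v u" for v
  proof
    assume eq: "tri n v = tri n u"
    have "sublist v (seg W i (code_len i))" using v(2) by (simp add: i code_def strict_sublist_def)
    then obtain d where d: "v = seg W (i + d) (length v)" "d + length v \<le> code_len i"
      by (rule sublist_segD)
    have tot: "total_order n (tri n v)" using eq i tri_code R_order by simp
    have "R (i + d) = R i" using tri_seg_total[of "i + d" "length v"] tot eq i tri_code d(1) by metis
    then have "(i + d) mod N = i mod N" by (simp add: R_eq_iff)
    then have "N dvd d" by (simp add: mod_eq_dvd_iff_nat)
    moreover have "0 < length v" using v(1) by simp
    \<comment> \<open>As \<open>v\<close> is nonempty, its offset is strictly below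
      \<open>N\<close>; with \<open>N dvd d\<close> only 0 remains.\<close>
    then have "d < N" using d(2) code_len_le_N[of i] by linarith
    ultimately have "d = 0" using nat_dvd_not_less by blast
    then have "code_len i \<le> length v" using d(1) v(1) tot code_len_le[of "length v" i] by simp
    then have "v = u" using d \<open>d = 0\<close> i by (simp add: code_def)
    with v(2) show False by simp
  qed
  moreover have "cyclic_factor u (seg W 0 N)"
    unfolding cyclic_factor_seg i code_def using code_len code_len_le_N by blast
  ultimately show "u \<in> MT n (seg W 0 N)"
    unfolding MT_def using i tri_code R_order by auto
qed

text \<open>The first difference lies inside both codewords; otherwise one of them would be a common
  prefix of both conjugates and force \<open>R i = R j\<close>.\<close>

lemma lexord_code:
  assumes "i mod N \<noteq> j mod N"
  shows "(code i, code j) \<in> lexord (R i)"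
proof -
  obtain k where k: "\<And>l. l < k \<Longrightarrow> W (i + l) = W (j + l)" "(W (i + k), W (j + k)) \<in> R i"
    using R_less_bounded[OF assms] by blast
  have agree: "seg W i l = seg W j l" if "l \<le> k" for l
    using k(1) that by (simp add: seg_eq_iff)
  have "k < code_len i"
  proof (rule ccontr)
    assume "\<not> k < code_len i"
    then have "R i = R j" using agree[of "code_len i"] code_len(2)[of i] tri_seg_total[of _ "code_len i"] by (metis not_less)
    with assms show False by (simp add: R_eq_iff)
  qed
  moreover have "k < code_len j"
  proof (rule ccontr)
    assume "\<not> k < code_len j"
    then have "R i = R j" using agree[of "code_len j"] code_len(2)[of j] tri_seg_total[of _ "code_len j"] by (metis not_less)
    with assms show False by (simp add: R_eq_iff)
  qed
  ultimately show ?thesis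
    unfolding lexord_take_index_conv code_def using k(2) agree[of k] take_seg
    by (intro disjI2 exI[of _ k]) (simp add: take_seg)
qed

text \<open>
  The letters of \<open>seg W i l\<close> are the smallest ones for \<open>R i\<close>, so exchanging two later neighbours
  in this order cannot affect the first \<open>l\<close> letters of the least conjugate.
\<close>

lemma code_prefix_shared:
  assumes "0 < l" "l < code_len i"
  obtains j where "i mod N \<noteq> j mod N" "seg W j l = seg W i l" "l < code_len j"
proof -
  let ?u = "seg W i l"
  define S where "S = {(a, b) \<in> R i. a \<notin> set ?u}"
  \<comment> \<open>The letters outside \<open>?u\<close> are closed upwards in
    \<open>R i\<close>.\<close>
  have out: "b \<notin> set ?u" if "(a, b) \<in> R i" "a \<notin> set ?u" for a b
  proof
    assume "b \<in> set ?u"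
    moreover have "a \<in> alphabet n" "b \<in> alphabet n" using that(1) total_orderD(1)[OF R_order[of i]] by auto
    ultimately have "(b, a) \<in> tri n ?u" using that(2) unfolding tri_def by blast
    moreover have "tri n ?u \<subseteq> tri n (seg W i N)"
      using assms(2) code_len_le_N[of i] by (intro tri_mono_prefix prefix_seg) simp
    ultimately show False using that(1) R_asym by (auto simp: tri_conjugate)
  qed
  have "\<not> total_order n (tri n ?u)" using tri_seg_total_iff assms by simp
  then obtain a b where "a \<in> alphabet n" "b \<in> alphabet n" "a \<noteq> b" "a \<notin> set ?u" "b \<notin> set ?u"
    unfolding total_order_tri_iff by blast
  then have "(a, b) \<in> S \<or> (b, a) \<in> S"
    using total_orderD(4)[OF R_order[of i]] unfolding S_def total_on_def by blast
  then have "S \<noteq> {}" by auto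
  moreover have "S \<subseteq> R i" by (auto simp: S_def)
  moreover have "(a, c) \<in> S \<or> (c, b) \<in> S" if "(a, b) \<in> S" "(a, c) \<in> R i" "(c, b) \<in> R i" for a b c
    using that by (auto simp: S_def)
  ultimately obtain a b where ab: "(a, b) \<in> S" "\<And>c. (a, c) \<in> R i \<Longrightarrow> (c, b) \<notin> R i"
    using adjacent_pair_exists[OF R_order[of i], of S] by blast
  then have abR: "(a, b) \<in> R i" "a \<notin> set ?u" "b \<notin> set ?u" using out by (auto simp: S_def)
  obtain j k where neq: "i mod N \<noteq> j mod N" and k: "\<And>l. l < k \<Longrightarrow> W (i + l) = W (j + l)"
    and Wk: "W (i + k) = a"
    using R_flip[OF abR(1) ab(2)] by blast
  have "l \<le> k"
  proof (rule ccontr)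
    assume "\<not> l \<le> k"
    then have "W (i + k) \<in> set ?u" by (auto simp: seg_def)
    with abR(2) Wk show False by simp
  qed
  then have eq: "seg W j l = ?u" using k by (simp add: seg_eq_iff)
  moreover have "l < code_len j"
    using eq tri_seg_total_iff[OF assms(1)] assms(2) by (metis not_less)
  ultimately show thesis using neq that by blast
qed

section \<open>The codewords form a Hamiltonian lex-code\<close>

text \<open>Every order is some \<open>R j\<close> with minimum \<open>code j\<close>, and
  \<open>code j\<close> determines \<open>R j\<close>; this gives uniqueness. The second property
  comes from \<open>code_prefix_shared\<close>.\<close>

lemma lex_code_code: "lex_code n (range code)"
unfolding lex_code_def
proof (intro conjI ballI allI impI)
  show "range code \<subseteq> lists (alphabet n)"
    using W_alphabet by (auto simp: code_def seg_def)
next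
  fix x assume x: "x \<in> range code"
  show "\<exists>!r. total_order n r \<and> lex_minimum r (range code) x"
  proof -
    obtain i where i: "x = code i" using x by blast
    have min: "lex_minimum (R j) (range code) (code j)" for j
      using lexord_code[of j] by (auto simp: lex_minimum_def code_eq_iff)
    have "r = R i" if r: "total_order n r" "lex_minimum r (range code) x" for r
    proof -
      obtain j where j: "r = R j" using R_surj r(1) by blast
      have "code j = code i"
      proof (rule ccontr)
        assume "code j \<noteq> code i"
        then have "(code j, code i) \<in> lexord (R j)" "(code i, code j) \<in> lexord (R j)"
          using min[of j] r(2) i j by (auto simp: lex_minimum_def)
        then show False using lexord_asymmetric[OF total_orderD(5)[OF R_order]] by blast
      qed
      then show ?thesis using j by (simp add: code_eq_iff R_eq_iff)
    qed
    then show ?thesis using min[of i] R_order[of i] i by blast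
  qed
next
  fix x u assume x: "x \<in> range code" and u: "u \<noteq> [] \<and> strict_prefix u x"
  show "\<exists>y\<in>range code. \<exists>z\<in>range code. y \<noteq> z \<and> prefix u y \<and> prefix u z"
  proof -
    obtain i where i: "x = code i" using x by blast
    have "prefix u x" "u \<noteq> x" using u by auto
    then have ul: "u = seg W i (length u)" "length u < code_len i"
      using prefix_segD[of u W i "code_len i"] i by (auto simp: code_def le_less)
    obtain j where j: "i mod N \<noteq> j mod N" "seg W j (length u) = u" "length u < code_len j"
      using code_prefix_shared[of "length u" i] u ul by (metis length_greater_0_conv)
    then have "prefix u (code j)"
      using prefix_seg[of "length u" "code_len j" W j] by (simp add: code_def)
    moreover have "code i \<noteq> code j" using j(1) code_eq_iff by simp
    ultimately show ?thesis using \<open>prefix u x\<close> i by blast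
  qed
qed

text \<open>An additional letter in front keeps the order of first occurrences total, so
  \<open>code i\<close> is at most one letter longer than \<open>code (Suc i)\<close>.\<close>

lemma code_arc: "prefix (code i) (W i # code (Suc i))"
proof -
  have "set (seg W (Suc i) l) \<subseteq> set (seg W i (Suc l))" for l
    by (auto simp: seg_Suc)
  then have "total_order n (tri n (seg W i (Suc (code_len (Suc i)))))"
    using code_len(2)[of "Suc i"] unfolding total_order_tri_iff by blast
  then have "code_len i \<le> Suc (code_len (Suc i))" by (simp add: code_len_le)
  then show ?thesis unfolding code_def seg_Suc[symmetric] by (rule prefix_seg)
qed

lemma hamiltonian_code: "hamiltonian (lex_digraph n (range code))"
proof -
  let ?G = "lex_digraph n (range code)"
  define p where "p = map (\<lambda>i. (code i, code (Suc i))) [0..<N]"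
  have cas: "pre_digraph.cas ?G (code i) (map (\<lambda>i. (code i, code (Suc i))) [i..<i + m]) (code (i + m))" for i m
  proof (induction m arbitrary: i)
    case (Suc m)
    show ?case using Suc[of "Suc i"]
      by (simp add: pre_digraph.cas.simps lex_digraph_def upt_conv_Cons del: upt_Suc)
  qed (simp add: pre_digraph.cas.simps)
  have "set p \<subseteq> arcs ?G"
    using code_arc W_alphabet by (fastforce simp: p_def lex_digraph_def)
  moreover have "pre_digraph.cas ?G (code 0) p (code 0)"
    using cas[of 0 N] code_cong[of N 0] by (simp add: p_def)
  ultimately have walk: "pre_digraph.awalk ?G (code 0) p (code 0)"
    by (simp add: pre_digraph.awalk_def lex_digraph_def)
  have heads: "map (head ?G) p = map (\<lambda>i. code (Suc i)) [0..<N]"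
    by (simp add: p_def lex_digraph_def)
  have "inj_on (\<lambda>i. code (Suc i)) {..<N}"
  proof (rule inj_onI)
    fix i j assume *: "i \<in> {..<N}" "j \<in> {..<N}" "code (Suc i) = code (Suc j)"
    then have "Suc i mod N = Suc j mod N" by (simp add: code_eq_iff)
    with * show "i = j" by (auto simp: mod_Suc split: if_splits)
  qed
  then have "distinct (map (head ?G) p)"
    unfolding heads by (simp add: distinct_map atLeast0LessThan)
  moreover have "tl (pre_digraph.awalk_verts ?G (code 0) p) = map (head ?G) p"
    using pre_digraph.awalk_verts_conv'[of ?G "code 0" p "code 0"] walk N_pos
    by (auto simp: pre_digraph.awalk_def p_def)
  ultimately have "pre_digraph.cycle ?G p"
    using walk N_pos by (auto simp: pre_digraph.cycle_def p_def)
  moreover have "head ?G ` set p = range code"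
  proof -
    have "code i \<in> (\<lambda>i. code (Suc i)) ` {0..<N}" for i
    proof -
      \<comment> \<open>The cyclic predecessor of \<open>i\<close>; adding \<open>N\<close> first
        keeps the natural subtraction exact at 0.\<close>
      have "code i = code (Suc ((i + N - 1) mod N))"
        using N_pos by (intro code_cong) (simp add: mod_Suc_eq)
      then show ?thesis using N_pos by force
    qed
    then show ?thesis
      unfolding set_map[symmetric] heads by auto
  qed
  ultimately show ?thesis
    unfolding hamiltonian_def by (auto simp: lex_digraph_def)
qed

theorem hamiltonian_lex_code_MT: "hamiltonian_lex_code n (MT n (seg W 0 N))"
  using lex_code_code hamiltonian_code by (simp add: hamiltonian_lex_code_def MT_eq)

end

section \<open>Conjugates as windows of a periodic sequence\<close>

lemma lexord_seg_iff:
  "(seg W i N, seg W j N) \<in> lexord r \<longleftrightarrow>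
     (\<exists>k<N. (\<forall>l<k. W (i + l) = W (j + l)) \<and> (W (i + k), W (j + k)) \<in> r)"
  unfolding lexord_take_index_conv by (auto simp: take_seg seg_eq_iff)

lemma proper_conjugates_seg:
  assumes per: "\<And>i. W (i mod N) = W i"
  shows "proper_conjugates (seg W i N) = {seg W (i + d) N | d. 0 < d \<and> d < N}"
proof -
  have split: "seg W i N = seg W i d @ seg W (i + d) (N - d)"
    "seg W (i + d) N = seg W (i + d) (N - d) @ seg W i d" if "d \<le> N" for d
  proof -
    show "seg W i N = seg W i d @ seg W (i + d) (N - d)"
      using that seg_add[of W i d "N - d"] by simp
    have "W (i + N + k) = W (i + k)" for k
      using per by (metis add.assoc add.commute mod_add_self2)
    then have "seg W (i + N) d = seg W i d" by (simp add: seg_eq_iff)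
    then show "seg W (i + d) N = seg W (i + d) (N - d) @ seg W i d"
      using that seg_add[of W "i + d" "N - d" d] by simp
  qed
  show ?thesis
  proof (intro equalityI subsetI)
    fix v assume "v \<in> proper_conjugates (seg W i N)"
    then obtain w1 w2 where w: "v = w2 @ w1" "seg W i N = w1 @ w2" "w1 \<noteq> []" "w2 \<noteq> []"
      unfolding proper_conjugates_def by blast
    have len: "N = length w1 + length w2" using arg_cong[OF w(2), of length] by simp
    then have "v = seg W (i + length w1) N"
      using split[of "length w1"] w by simp
    moreover have "0 < length w1" "length w1 < N" using len w by auto
    ultimately show "v \<in> {seg W (i + d) N | d. 0 < d \<and> d < N}" by blast
  next
    fix v assume "v \<in> {seg W (i + d) N | d. 0 < d \<and> d < N}"
    then obtain d where d: "v = seg W (i + d) N" "0 < d" "d < N" by blast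
    then have "seg W i d \<noteq> []" "seg W (i + d) (N - d) \<noteq> []" by auto
    moreover have "seg W i N = seg W i d @ seg W (i + d) (N - d)" "v = seg W (i + d) (N - d) @ seg W i d"
      using d split[of d] by simp_all
    ultimately show "v \<in> proper_conjugates (seg W i N)"
      unfolding proper_conjugates_def by blast
  qed
qed

context cyclic_lyndon
begin

text \<open>\<open>R\<close> is a bijection from the residues modulo \<open>N\<close> onto the total
  orders.\<close>

lemma N_eq_fact: "N = fact n"
proof -
  have "bij_betw R {..<N} {r. total_order n r}"
    unfolding bij_betw_def
  proof
    show "inj_on R {..<N}" by (auto simp: inj_on_def R_eq_iff)
    have "r \<in> R ` {..<N}" if r: "total_order n r" for r
    proof -
      obtain i where "r = R i" using R_surj[OF r] by blast
      then have "r = R (i mod N)" "i mod N < N" using R_mod N_pos by simp_all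
      then show ?thesis by blast
    qed
    then show "R ` {..<N} = {r. total_order n r}" using R_order by auto
  qed
  then have "card {..<N} = card {r. total_order n r}" by (rule bij_betw_same_card)
  then show ?thesis by (simp add: card_total_orders)
qed

theorem universal_lyndon_seg: "universal_lyndon n (seg W 0 N)"
proof -
  have in_alphabet: "seg W i N \<in> lists (alphabet n)" for i
    using W_alphabet by (auto simp: seg_def)
  have "lyndon n (seg W i N)" for i
  proof -
    have "(seg W i N, seg W (i + d) N) \<in> lexord (R i)" if d: "0 < d" "d < N" for d
    proof -
      have "i mod N \<noteq> (i + d) mod N"
      proof
        assume "i mod N = (i + d) mod N"
        then have "N dvd d" by (metis mod_eq_dvd_iff_nat diff_add_inverse le_add1)
        with d nat_dvd_not_less show False by blast
      qed
      then show ?thesis unfolding lexord_seg_iff using R_less_bounded by metis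
    qed
    then show ?thesis
      unfolding lyndon_def proper_conjugates_seg[of W N, OF W_mod] using in_alphabet R_order by blast
  qed
  moreover have "\<exists>i. v = seg W i N" if "v \<in> conjugates (seg W 0 N)" for v
    using that unfolding conjugates_def proper_conjugates_seg[of W N, OF W_mod] by blast
  ultimately have "\<forall>v\<in>conjugates (seg W 0 N). lyndon n v" by metis
  then show ?thesis
    unfolding universal_lyndon_def using in_alphabet[of 0] N_eq_fact by simp
qed

end

section \<open>From universal Lyndon words to lex-codes and back\<close>

text \<open>Distinct conjugates cannot be least for the same order, so the \<open>fact n\<close>
  conjugates use \<open>fact n\<close> different orders, which are all of them. This supplies the
  surjectivity required by the locale.\<close>

lemma universal_lyndon_cyclic_lyndon:
  assumes "universal_lyndon n w"
  obtains W R where "cyclic_lyndon n (length w) W R" "w = seg W 0 (length w)"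
proof -
  define N where "N = length w"
  define W where "W i = w ! (i mod N)" for i
  have N: "N = fact n" using assms by (simp add: universal_lyndon_def N_def)
  have N_pos: "0 < N" by (simp add: N)
  have W_mod: "W (i mod N) = W i" for i by (simp add: W_def)
  have w: "w = seg W 0 N"
    by (rule nth_equalityI) (auto simp: W_def N_def)
  have cong: "seg W i N = seg W j N" if "i mod N = j mod N" for i j
    unfolding seg_eq_iff using that W_mod by (metis mod_add_left_eq)
  have "\<exists>r. total_order n r \<and> (\<forall>j. i mod N \<noteq> j mod N \<longrightarrow> (seg W i N, seg W j N) \<in> lexord r)" for i
  proof -
    have "seg W (i mod N) N \<in> conjugates w"
    proof (cases "i mod N = 0")
      case True
      then show ?thesis by (simp add: conjugates_def w[symmetric])
    next
      case False
      moreover have "i mod N < N" using N_pos by simp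
      ultimately have "seg W (0 + i mod N) N \<in> proper_conjugates w"
        unfolding w proper_conjugates_seg[of W N, OF W_mod] by blast
      then show ?thesis by (simp add: conjugates_def)
    qed
    then have "lyndon n (seg W i N)"
      using assms cong[of i "i mod N"] by (simp add: universal_lyndon_def)
    then obtain r where r: "total_order n r"
      "\<And>d. 0 < d \<Longrightarrow> d < N \<Longrightarrow> (seg W i N, seg W (i + d) N) \<in> lexord r"
      unfolding lyndon_def proper_conjugates_seg[of W N, OF W_mod] by blast
    have "(seg W i N, seg W j N) \<in> lexord r" if neq: "i mod N \<noteq> j mod N" for j
    proof -
      \<comment> \<open>The cyclic distance from \<open>i\<close> to \<open>j\<close>, which turns
        an arbitrary start \<open>j\<close> into a proper conjugate.\<close>
      define d where "d = (j + (N - i mod N)) mod N"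
      have "d < N" using N_pos by (simp add: d_def)
      have "i mod N < N" using N_pos by simp
      have "(i + d) mod N = (i mod N + (j + (N - i mod N))) mod N"
        unfolding d_def by (metis mod_add_eq mod_mod_trivial)
      also have "i mod N + (j + (N - i mod N)) = j + N" using \<open>i mod N < N\<close> by simp
      finally have j: "(i + d) mod N = j mod N" by simp
      have "d \<noteq> 0" using j neq by (metis add.right_neutral)
      then show ?thesis using r(2)[of d] \<open>d < N\<close> cong[OF j] by simp
    qed
    with r(1) show ?thesis by blast
  qed
  then obtain R0 where R0: "\<And>i. total_order n (R0 i)"
    "\<And>i j. i mod N \<noteq> j mod N \<Longrightarrow> (seg W i N, seg W j N) \<in> lexord (R0 i)"
    by metis
  \<comment> \<open>The chosen orders \<open>R0\<close> need not be periodic.\<close>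
  define R where "R i = R0 (i mod N)" for i
  have R_order: "total_order n (R i)" for i using R0(1) by (simp add: R_def)
  have R_less: "(seg W i N, seg W j N) \<in> lexord (R i)" if "i mod N \<noteq> j mod N" for i j
    using R0(2)[of "i mod N" j] that cong[of "i mod N" i] by (simp add: R_def)
  have "inj_on R {..<N}"
  proof (rule inj_onI, rule ccontr)
    fix i j assume "i \<in> {..<N}" "j \<in> {..<N}" "R i = R j" "i \<noteq> j"
    then have "(seg W i N, seg W j N) \<in> lexord (R i)" "(seg W j N, seg W i N) \<in> lexord (R i)"
      using R_less[of i j] R_less[of j i] by simp_all
    then show False using lexord_asymmetric[OF total_orderD(5)[OF R_order]] by blast
  qed
  then have "card (R ` {..<N}) = card {r. total_order n r}"
    by (simp add: card_image card_total_orders N)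
  moreover have "R ` {..<N} \<subseteq> {r. total_order n r}" using R_order by auto
  ultimately have R_surj: "R ` {..<N} = {r. total_order n r}"
    using card_subset_eq[OF finite_total_orders] by blast
  have "W i \<in> alphabet n" for i
  proof -
    have "W i \<in> set w" using N_pos by (simp add: W_def N_def)
    then show ?thesis using assms unfolding universal_lyndon_def by blast
  qed
  moreover have "\<exists>i. r = R i" if "total_order n r" for r
    using that R_surj by blast
  moreover have "\<exists>k. (\<forall>l<k. W (i + l) = W (j + l)) \<and> (W (i + k), W (j + k)) \<in> R i"
    if "i mod N \<noteq> j mod N" for i j
    using R_less[OF that] unfolding lexord_seg_iff by blast
  moreover have "R (i mod N) = R i" for i by (simp add: R_def)
  ultimately have "cyclic_lyndon n N W R"
    using N_pos W_mod R_order by unfold_locales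
  then show thesis using that w unfolding N_def by blast
qed

section \<open>A Hamiltonian cycle as a periodic sequence of vertices\<close>

lemma (in pre_digraph) cas_nth:
  "cas u p v \<Longrightarrow> k < length p \<Longrightarrow>
     head G (p ! k) = (if Suc k < length p then tail G (p ! Suc k) else v)"
proof (induction p arbitrary: u k)
  case (Cons e p)
  then show ?case by (cases k; cases p) auto
qed simp

lemma lex_digraph_cycle:
  assumes "hamiltonian (lex_digraph n X)"
  obtains N x where "0 < N" "\<And>i. x (i mod N) = x i" "inj_on x {..<N}" "range x = X"
    "\<And>i. \<exists>a\<in>alphabet n. prefix (x i) (a # x (Suc i))"
proof -
  let ?G = "lex_digraph n X"
  obtain p u where p: "p \<noteq> []" "set p \<subseteq> arcs ?G" "pre_digraph.cas ?G u p u"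
    "distinct (tl (pre_digraph.awalk_verts ?G u p))" "snd ` set p = X"
    using assms unfolding hamiltonian_def pre_digraph.cycle_def pre_digraph.awalk_def
    by (auto simp: lex_digraph_def)
  define N where "N = length p"
  define x where "x i = fst (p ! (i mod N))" for i
  have N_pos: "0 < N" using p(1) by (simp add: N_def)
  have mod: "x (i mod N) = x i" for i by (simp add: x_def)
  have "fst (p ! 0) = u" using p(1,3) by (cases p) (auto simp: pre_digraph.cas.simps lex_digraph_def)
  then have snd_p: "snd (p ! k) = x (Suc k)" if "k < N" for k
    using pre_digraph.cas_nth[OF p(3), of k] that
    by (cases "Suc k < N") (auto simp: x_def N_def lex_digraph_def not_less le_Suc_eq)
  have arc: "p ! (i mod N) = (x i, x (Suc i))" for i
  proof -
    have "x (Suc (i mod N)) = x (Suc i)" unfolding x_def by (simp add: mod_Suc_eq)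
    then show ?thesis using snd_p[of "i mod N"] N_pos by (simp add: x_def prod_eq_iff)
  qed
  have set_p: "p ! (i mod N) \<in> set p" for i using N_pos by (simp add: N_def)
  have "X = snd ` (\<lambda>k. p ! k) ` {..<N}"
    using p(5) by (simp add: N_def set_conv_nth image_image lessThan_def setcompr_eq_image)
  also have "\<dots> = (\<lambda>k. x (Suc k)) ` {..<N}"
    using snd_p by (auto simp: image_image)
  finally have X: "X = (\<lambda>k. x (Suc k)) ` {..<N}" .
  have "range x \<subseteq> X"
  proof clarify
    fix i show "x i \<in> X"
      using set_p[of i] p(2) arc[of i] by (auto simp: lex_digraph_def)
  qed
  then have range: "range x = X" using X by auto
  have img: "x ` {..<N} = X"
  proof -
    have "x i \<in> x ` {..<N}" for i using mod N_pos by (metis imageI lessThan_iff mod_less_divisor)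
    then show ?thesis using range by auto
  qed
  have "tl (pre_digraph.awalk_verts ?G u p) = map snd p"
    using pre_digraph.awalk_verts_conv'[OF p(3)] p(1) by (simp add: lex_digraph_def)
  \<comment> \<open>The heads of the \<open>N\<close> arcs are distinct and exhaust
    \<open>X\<close>; hence \<open>x\<close>, mapping \<open>N\<close> indices onto
    \<open>X\<close>, is injective on them.\<close>
  then have "card X = N"
    using p(4,5) distinct_card[of "map snd p"] by (simp add: N_def)
  then have "inj_on x {..<N}"
    using img by (intro eq_card_imp_inj_on) simp_all
  moreover have "\<exists>a\<in>alphabet n. prefix (x i) (a # x (Suc i))" for i
    using set_p[of i] p(2) arc[of i] by (auto simp: lex_digraph_def)
  ultimately show thesis using that N_pos mod range by blast
qed

section \<open>From a Hamiltonian lex-code to a universal Lyndon word\<close>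

lemma ex_lex_minimum:
  assumes "total_order n r" "finite X" "X \<noteq> {}" "X \<subseteq> lists (alphabet n)"
  shows "\<exists>x. lex_minimum r X x"
proof -
  have "total_on X (lexord r)"
    using total_on_lexord[OF total_orderD(4)[OF assms(1)]] assms(4) by (auto simp: total_on_def)
  then show ?thesis
    using strict_linear_minimum[OF assms(2,3) lexord_transI[OF total_orderD(2)[OF assms(1)]]]
    unfolding lex_minimum_def by blast
qed

lemma lex_codeD:
  assumes "lex_code n X"
  shows "X \<subseteq> lists (alphabet n)"
    and "x \<in> X \<Longrightarrow> \<exists>!r. total_order n r \<and> lex_minimum r X x"
    and "x \<in> X \<Longrightarrow> u \<noteq> [] \<Longrightarrow> strict_prefix u x \<Longrightarrow>
      \<exists>y\<in>X. \<exists>z\<in>X. y \<noteq> z \<and> prefix u y \<and> prefix u z"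
  using assms unfolding lex_code_def by simp_all

text \<open>A proper prefix of \<open>y\<close> is smaller than \<open>y\<close> in every order, so
  \<open>y\<close> could be the minimum for none.\<close>

lemma lex_code_prefix_free:
  assumes "lex_code n X" "x \<in> X" "y \<in> X" "prefix x y"
  shows "x = y"
proof (rule ccontr)
  assume "x \<noteq> y"
  obtain r where r: "total_order n r" "lex_minimum r X y"
    using lex_codeD(2)[OF assms(1,3)] by blast
  have "(x, y) \<in> lexord r"
    using assms(4) \<open>x \<noteq> y\<close> by (cases rule: prefixE) (auto simp: neq_Nil_conv intro: lexord_append_rightI)
  moreover have "(y, x) \<in> lexord r"
    using r(2) assms(2) \<open>x \<noteq> y\<close> by (auto simp: lex_minimum_def)
  ultimately show False using lexord_asymmetric[OF total_orderD(5)[OF r(1)]] by blast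
qed

theorem hamiltonian_lex_code_imp_MT:
  assumes "hamiltonian_lex_code n X" "X \<noteq> {[]}"
  obtains w where "universal_lyndon n w" "X = MT n w"
proof -
  have lc: "lex_code n X" using assms(1) by (simp add: hamiltonian_lex_code_def)
  obtain N x where N_pos: "0 < N" and x_mod: "\<And>i. x (i mod N) = x i" and inj: "inj_on x {..<N}"
    and X: "range x = X" and arc: "\<And>i. \<exists>a\<in>alphabet n. prefix (x i) (a # x (Suc i))"
    using lex_digraph_cycle assms(1) unfolding hamiltonian_lex_code_def by blast
  have x_eq_iff: "x i = x j \<longleftrightarrow> i mod N = j mod N" for i j
    using inj x_mod N_pos by (metis inj_on_def lessThan_iff mod_less_divisor)
  have xX: "x i \<in> X" for i using X by blast
  have nonempty: "x i \<noteq> []" for i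
  proof
    assume "x i = []"
    \<comment> \<open>The empty word is a prefix of everything, so prefix-freeness leaves only the
      excluded case.\<close>
    then have "y = []" if "y \<in> X" for y using lex_code_prefix_free[OF lc xX that, of i] by simp
    then have "X \<subseteq> {[]}" by auto
    then show False using assms(2) xX[of i] by (auto simp: subset_singleton_iff)
  qed
  define W where "W i = hd (x i)" for i
  \<comment> \<open>By the arc condition, \<open>x i\<close> without its first letter is a prefix of
    \<open>x (Suc i)\<close>; following the cycle reads off its letters one by one.\<close>
  have nth_x: "x i ! k = W (i + k)" if "k < length (x i)" for i k
    using that
  proof (induction k arbitrary: i)
    case 0
    then show ?case by (simp add: W_def hd_conv_nth)
  next
    case (Suc k)
    obtain a where "prefix (x i) (a # x (Suc i))" using arc by blast
    then obtain q where "a # x (Suc i) = x i @ q" by (auto simp: prefix_def)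
    then have "x i ! Suc k = x (Suc i) ! k" "k < length (x (Suc i))"
      using Suc.prems by (metis nth_Cons_Suc nth_append, metis Suc_less_eq length_Cons length_append trans_less_add1)
    then show ?case using Suc.IH[of "Suc i"] by simp
  qed
  have x_seg: "x i = seg W i (length (x i))" for i
    by (rule nth_equalityI) (auto simp: nth_x)
  have "\<exists>r. total_order n r \<and> lex_minimum r X y" if "y \<in> X" for y
    using lex_codeD(2)[OF lc that] by blast
  then obtain R0 where R0: "\<And>y. y \<in> X \<Longrightarrow> total_order n (R0 y)" "\<And>y. y \<in> X \<Longrightarrow> lex_minimum (R0 y) X y"
    by metis
  interpret cyclic_lyndon n N W "\<lambda>i. R0 (x i)"
  proof
    show "0 < N" by (fact N_pos)
    show "W (i mod N) = W i" "R0 (x (i mod N)) = R0 (x i)" for i by (simp_all add: W_def x_mod)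
    show "total_order n (R0 (x i))" for i using R0(1) xX by blast
    show "W i \<in> alphabet n" for i
    proof -
      have "x i \<in> lists (alphabet n)" using lex_codeD(1)[OF lc] xX by blast
      then show ?thesis unfolding W_def using nonempty[of i] by (cases "x i") auto
    qed
    show "\<exists>i. r = R0 (x i)" if r: "total_order n r" for r
    proof -
      have "x i \<in> x ` {..<N}" for i using x_mod N_pos by (metis imageI lessThan_iff mod_less_divisor)
      then have "X = x ` {..<N}" using X by auto
      then obtain y where y: "lex_minimum r X y"
        using ex_lex_minimum[OF r _ _ lex_codeD(1)[OF lc]] xX by (metis empty_iff finite_imageI finite_lessThan)
      then have "y \<in> X" by (simp add: lex_minimum_def)
      then have "r = R0 y" using lex_codeD(2)[OF lc] r y R0 by metis
      with \<open>y \<in> X\<close> X show ?thesis by blast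
    qed
    show "\<exists>k. (\<forall>l<k. W (i + l) = W (j + l)) \<and> (W (i + k), W (j + k)) \<in> R0 (x i)"
      if neq: "i mod N \<noteq> j mod N" for i j
    proof -
      have "x i \<noteq> x j" using neq x_eq_iff by simp
      \<comment> \<open>As \<open>x i\<close> is no prefix of \<open>x j\<close>, the comparison is
        decided at a position inside both words, where \<open>nth_x\<close> transfers it to
        \<open>W\<close>.\<close>
      then have "(x i, x j) \<in> lexord (R0 (x i))" "\<not> prefix (x i) (x j)"
        using R0(2)[OF xX[of i]] xX lex_code_prefix_free[OF lc] by (auto simp: lex_minimum_def)
      moreover have "prefix (x i) (x j)" if "take (length (x i)) (x j) = x i"
        using that take_is_prefix by metis
      ultimately obtain k where k: "k < length (x i)" "k < length (x j)" "take k (x i) = take k (x j)"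
        "(x i ! k, x j ! k) \<in> R0 (x i)"
        unfolding lexord_take_index_conv by auto
      have "W (i + l) = W (j + l)" if "l < k" for l
        using arg_cong[OF k(3), of "\<lambda>u. u ! l"] that k(1,2) nth_x by simp
      then show ?thesis using k nth_x by auto
    qed
  qed
  have "x i = code i" for i
  proof -
    \<comment> \<open>Otherwise the second property of \<open>X\<close> gives another
      \<open>x j\<close> starting with \<open>code i\<close>. This prefix already determines the
      order, so \<open>x i\<close> and \<open>x j\<close> would have the same order.\<close>
    have "\<not> code_len i < length (x i)"
    proof
      assume less: "code_len i < length (x i)"
      then have "prefix (code i) (x i)"
        using prefix_seg[of "code_len i" "length (x i)" W i] x_seg[of i] by (simp add: code_def)
      moreover have "length (code i) \<noteq> length (x i)" using less by (simp add: code_def)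
      then have "code i \<noteq> x i" by metis
      moreover have "code i \<noteq> []" using code_len(1)[of i] by (simp add: code_def)
      ultimately obtain y z where yz: "y \<in> X" "z \<in> X" "y \<noteq> z" "prefix (code i) y" "prefix (code i) z"
        using lex_codeD(3)[OF lc xX[of i], of "code i"] unfolding strict_prefix_def by blast
      then have "\<exists>y\<in>X. y \<noteq> x i \<and> prefix (code i) y" by metis
      then obtain j where j: "x j \<noteq> x i" "prefix (code i) (x j)" unfolding X[symmetric] by blast
      then have "code i = seg W j (code_len i)"
        using prefix_segD[of "code i" W j "length (x j)"] x_seg[of j] by (simp add: code_def)
      then have "R0 (x j) = R0 (x i)"
        using tri_seg_total[of j "code_len i"] tri_code[of i] R_order[of i] by simp
      then show False using R_eq_iff j(1) x_eq_iff by simp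
    qed
    \<comment> \<open>Otherwise the second property of the codewords gives a start \<open>j\<close>
      in another residue class whose sequence begins with \<open>x i\<close>; then
      \<open>x i\<close> and \<open>x j\<close> are comparable prefixes, against
      prefix-freeness.\<close>
    moreover have "\<not> length (x i) < code_len i"
    proof
      assume "length (x i) < code_len i"
      moreover have "0 < length (x i)" using nonempty by simp
      ultimately obtain j where j: "i mod N \<noteq> j mod N" "seg W j (length (x i)) = seg W i (length (x i))"
        using code_prefix_shared by metis
      then have "x i = seg W j (length (x i))" using x_seg by simp
      then have "prefix (x i) (x j) \<or> prefix (x j) (x i)"
        using prefix_seg[of _ _ W j] x_seg[of j] by (metis linear)
      then have "x i = x j" using lex_code_prefix_free[OF lc] xX by metis
      with j(1) x_eq_iff show False by simp
    qed
    ultimately have "length (x i) = code_len i" by simp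
    then show ?thesis using x_seg[of i] by (simp add: code_def)
  qed
  then have "X = MT n (seg W 0 N)" using X MT_eq by auto
  with universal_lyndon_seg that show thesis by blast
qed

theorem theorem4:
  fixes n :: nat
  shows "(\<forall>w. universal_lyndon n w \<longrightarrow> hamiltonian_lex_code n (MT n w)) \<and>
    (\<forall>X. hamiltonian_lex_code n X \<and> X \<noteq> {[]} \<longrightarrow> (\<exists>w. universal_lyndon n w \<and> X = MT n w))"
proof (intro conjI allI impI)
  fix w assume "universal_lyndon n w"
  then obtain W R where "cyclic_lyndon n (length w) W R" "w = seg W 0 (length w)"
    by (rule universal_lyndon_cyclic_lyndon)
  then show "hamiltonian_lex_code n (MT n w)"
    using cyclic_lyndon.hamiltonian_lex_code_MT by metis
next
  fix X assume "hamiltonian_lex_code n X \<and> X \<noteq> {[]}"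
  then show "\<exists>w. universal_lyndon n w \<and> X = MT n w"
    using hamiltonian_lex_code_imp_MT by metis
qed

end
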